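(* A Hamiltonian system of conservation laws $$u^i_t=\varepsilon^i\frac{d}{dx}\left(\frac{\partial h(u)}{\partial u^i}\right),\qquad i=1,\dots,n\quad(\text{no summation}),\qquad\varepsilon^i=\pm1,$$ is auto-dual: if $\Sigma\subset\mathbb P^{n+3}$ is its ruled hypersurface, then the points of the dual hypersurface $\Sigma^*\subset(\mathbb P^{n+3})^*$ are the polar hyperplanes of the corresponding points of $\Sigma$ with respect to the quadric $(X,X)=0$, where $$(X,Y)=\varepsilon^1X_1Y_1+\dots+\varepsilon^nX_nY_n-X_0Y_{n+1}-X_{n+1}Y_0-X_{n+2}Y_{n+3}-X_{n+3}Y_{n+2}.$$
   Context: All considerations are local and smooth, over $\mathbb R$; ruled hypersurfaces are considered up to projective equivalence. Put $h_i=\partial h/\partial u^i$, $\nabla h=(h_1,\dots,h_n)$, $|v|^2=\sum_i\varepsilon^i(v_i)^2$. The system has the $n+2$ conservation laws $u^i\,dx+\varepsilon^ih_i\,dt$ ($i=1,\dots,n$), $\frac12|u|^2\,dx+(\sum_ih_iu^i-h)\,dt$, $h\,dx+\frac12|\nabla h|^2\,dt$ (closed on solutions). It is assumed that these forms together with $dx$ and $dt$ are linearly independent over $\mathbb R$. The ruled hypersurface $\Sigma$ of the system is the $(n+1)$-dimensional submanifold of $\mathbb P^{n+3}$ (homogeneous coordinates indexed $0,\dots,n+3$) swept out by the lines (parametrized by $u$) spanned by the points $$p=[1:u^1:\dots:u^n:\tfrac12|u|^2:h:0],\qquad r=[0:\varepsilon^1h_1:\dots:\varepsilon^nh_n:\textstyle\sum_ih_iu^i-h:\tfrac12|\nabla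 h|^2:1].$$ These lines lie on the quadric $(X,X)=0$. The dual hypersurface $\Sigma^*$ is the set of points of the dual projective space $(\mathbb P^{n+3})^*$ corresponding to the hyperplanes tangent to $\Sigma$. Two systems of conservation laws, each admitting two additional conservation laws, are dual to each other if their ruled hypersurfaces are dual; a system is auto-dual if it is dual to itself. The polar hyperplane of a point $[X]$ is $\{[Y]:(X,Y)=0\}$. *)

theory Defs
  imports "HOL-Analysis.Analysis"
begin

section \<open>Smooth maps on open sets\<close>

fun Ck_on :: "nat \<Rightarrow> 'a::euclidean_space set \<Rightarrow> ('a \<Rightarrow> 'b::real_normed_vector) \<Rightarrow> bool" where
  "Ck_on 0 U f \<longleftrightarrow> continuous_on U f"
| "Ck_on (Suc k) U f \<longleftrightarrow>
     f differentiable_on U \<and> (\<forall>v. Ck_on k U (\<lambda>x. frechet_derivative f (at x) v))"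

definition smooth_on :: "'a::euclidean_space set \<Rightarrow> ('a \<Rightarrow> 'b::real_normed_vector) \<Rightarrow> bool" where
  "smooth_on U f \<longleftrightarrow> (\<forall>k. Ck_on k U f)"

definition partial :: "'n \<Rightarrow> (real ^ 'n::finite \<Rightarrow> real) \<Rightarrow> real ^ 'n \<Rightarrow> real" where
  "partial i h u = frechet_derivative h (at u) (axis i 1)"


section \<open>Systems of conservation laws with two additional conservation laws\<close>

text \<open>
  The system \<open>u\<^sup>i\<^sub>t = (f\<^sup>i(u))\<^sub>x\<close> on the open set \<open>state\<close>, with \<open>f = flux\<close>, together with
  the two further forms \<open>dens\<^sub>k dx + flux\<^sub>k dt\<close>.
\<close>

record 'n cl_system =
  state :: "(real ^ 'n) set"
  flux  :: "real ^ 'n \<Rightarrow> real ^ 'n"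
  dens1 :: "real ^ 'n \<Rightarrow> real"
  flux1 :: "real ^ 'n \<Rightarrow> real"
  dens2 :: "real ^ 'n \<Rightarrow> real"
  flux2 :: "real ^ 'n \<Rightarrow> real"

text \<open>Functions of the independent variables take a pair \<open>(x, t)\<close>.\<close>

definition d_x :: "(real \<times> real \<Rightarrow> 'b::real_normed_vector) \<Rightarrow> real \<times> real \<Rightarrow> 'b" where
  "d_x w z = frechet_derivative w (at z) (1, 0)"

definition d_t :: "(real \<times> real \<Rightarrow> 'b::real_normed_vector) \<Rightarrow> real \<times> real \<Rightarrow> 'b" where
  "d_t w z = frechet_derivative w (at z) (0, 1)"

definition solution ::
  "'n::finite cl_system \<Rightarrow> (real \<times> real) set \<Rightarrow> (real \<times> real \<Rightarrow> real ^ 'n) \<Rightarrow> bool" where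
  "solution S W w \<longleftrightarrow> open W \<and> smooth_on W w \<and> w ` W \<subseteq> state S \<and>
     (\<forall>z\<in>W. d_t w z = d_x (\<lambda>z. flux S (w z)) z)"

text \<open>The form \<open>g dx + q dt\<close> is closed on every (local, smooth) solution.\<close>

definition conservation_law ::
  "'n::finite cl_system \<Rightarrow> (real ^ 'n \<Rightarrow> real) \<Rightarrow> (real ^ 'n \<Rightarrow> real) \<Rightarrow> bool" where
  "conservation_law S g q \<longleftrightarrow> smooth_on (state S) g \<and> smooth_on (state S) q \<and>
     (\<forall>W w. solution S W w \<longrightarrow> (\<forall>z\<in>W. d_t (\<lambda>z. g (w z)) z = d_x (\<lambda>z. q (w z)) z))"

text \<open>
  Linear independence over the reals of \<open>dx\<close>, \<open>dt\<close>, \<open>u\<^sup>i dx + f\<^sup>i dt\<close> and the two additional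
  forms: a combination with constant coefficients \<open>a, b, c, c1, c2\<close> vanishes only trivially.
\<close>

definition independent_forms :: "'n::finite cl_system \<Rightarrow> bool" where
  "independent_forms S \<longleftrightarrow>
     (\<forall>(a::real) (b::real) (c::real ^ 'n) (c1::real) (c2::real).
        (\<forall>u\<in>state S.
           a + (\<Sum>i\<in>UNIV. c $ i * u $ i) + c1 * dens1 S u + c2 * dens2 S u = 0 \<and>
           b + (\<Sum>i\<in>UNIV. c $ i * flux S u $ i) + c1 * flux1 S u + c2 * flux2 S u = 0)
        \<longrightarrow> a = 0 \<and> b = 0 \<and> c = 0 \<and> c1 = 0 \<and> c2 = 0)"

definition two_additional_laws :: "'n::finite cl_system \<Rightarrow> bool" where
  "two_additional_laws S \<longleftrightarrow> open (state S) \<and> smooth_on (state S) (flux S) \<and>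
     conservation_law S (dens1 S) (flux1 S) \<and> conservation_law S (dens2 S) (flux2 S) \<and>
     independent_forms S"


section \<open>Projective spaces, hyperplanes and duality\<close>

text \<open>
  Points of the projective space \<open>P(V)\<close> are represented by one-dimensional subspaces of \<open>V\<close>,
  hyperplanes by subspaces of codimension one, and points of the dual projective space by
  one-dimensional subspaces of the space of linear functionals on \<open>V\<close>.
\<close>

definition proj_hyperplane :: "'v::euclidean_space set \<Rightarrow> bool" where
  "proj_hyperplane H \<longleftrightarrow> subspace H \<and> Suc (dim H) = DIM('v)"

definition dual_point :: "'v::euclidean_space set \<Rightarrow> ('v \<Rightarrow>\<^sub>L real) set" where
  "dual_point H = {\<phi>. \<forall>Y\<in>H. blinfun_apply \<phi> Y = 0}"

definition proj_equivalent :: "'v::real_vector set set \<Rightarrow> 'w::real_vector set set \<Rightarrow> bool" where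
  "proj_equivalent A B \<longleftrightarrow> (\<exists>L. linear L \<and> bij L \<and> B = (\<lambda>P. L ` P) ` A)"


section \<open>Ruled submanifolds and their duals\<close>

text \<open>
  Below, \<open>p\<close> and \<open>r\<close> are homogeneous coordinate vectors of two points spanning the line with
  parameter \<open>u\<close>.
\<close>

definition generator ::
  "('u \<Rightarrow> 'v::euclidean_space) \<Rightarrow> ('u \<Rightarrow> 'v) \<Rightarrow> 'u \<Rightarrow> 'v set set" where
  "generator p r u = {span {X} | X. X \<in> span {p u, r u} \<and> X \<noteq> 0}"

definition ruled ::
  "'u set \<Rightarrow> ('u \<Rightarrow> 'v::euclidean_space) \<Rightarrow> ('u \<Rightarrow> 'v) \<Rightarrow> 'v set set" where
  "ruled U p r = (\<Union>u\<in>U. generator p r u)"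

definition cone_param ::
  "('u \<Rightarrow> 'v::euclidean_space) \<Rightarrow> ('u \<Rightarrow> 'v) \<Rightarrow> 'u \<times> real \<times> real \<Rightarrow> 'v" where
  "cone_param p r = (\<lambda>(u, s, t). s *\<^sub>R p u + t *\<^sub>R r u)"

text \<open>
  \<open>cone_param\<close> parametrizes the affine cone over the ruled submanifold, so the point
  \<open>[s p(u) + t r(u)]\<close> is a regular point (the map to projective space is an immersion there)
  iff the differential of \<open>cone_param\<close> is injective. The range of that differential is then
  the linear subspace representing the projective tangent space, and a hyperplane is tangent
  iff it contains this range. At a regular point the vector \<open>s p(u) + t r(u)\<close> is automatically
  nonzero: by linearity in \<open>(s, t)\<close> it is the image of the tangent vector \<open>(0, s, t)\<close>, and
  the derivative at \<open>s = t = 0\<close> is not injective.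
\<close>

definition tangent_hyperplanes_at ::
  "('u::euclidean_space \<Rightarrow> 'v::euclidean_space) \<Rightarrow> ('u \<Rightarrow> 'v) \<Rightarrow> 'u \<times> real \<times> real \<Rightarrow> 'v set set"
  where
  "tangent_hyperplanes_at p r z =
     {H. inj (frechet_derivative (cone_param p r) (at z)) \<and>
         proj_hyperplane H \<and> range (frechet_derivative (cone_param p r) (at z)) \<subseteq> H}"

definition tangent_hyperplanes_along ::
  "('u::euclidean_space \<Rightarrow> 'v::euclidean_space) \<Rightarrow> ('u \<Rightarrow> 'v) \<Rightarrow> 'u \<Rightarrow> 'v set set" where
  "tangent_hyperplanes_along p r u = (\<Union>s t. tangent_hyperplanes_at p r (u, s, t))"

definition dual_of_ruled ::
  "'u::euclidean_space set \<Rightarrow> ('u \<Rightarrow> 'v::euclidean_space) \<Rightarrow> ('u \<Rightarrow> 'v) \<Rightarrow> ('v \<Rightarrow>\<^sub>L real) set set"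
  where
  "dual_of_ruled U p r = dual_point ` (\<Union>u\<in>U. tangent_hyperplanes_along p r u)"


section \<open>The ruled hypersurface of a system\<close>

text \<open>
  The tuple \<open>(X\<^sub>0, (X\<^sub>1, \<dots>, X\<^sub>n), X\<^sub>n\<^sub>+\<^sub>1, X\<^sub>n\<^sub>+\<^sub>2, X\<^sub>n\<^sub>+\<^sub>3)\<close>
  of homogeneous coordinates, where \<open>n = CARD('n)\<close>.
\<close>

type_synonym 'n hcoords = "real \<times> (real ^ 'n) \<times> real \<times> real \<times> real"

definition pt_p :: "'n::finite cl_system \<Rightarrow> real ^ 'n \<Rightarrow> 'n hcoords" where
  "pt_p S u = (1, u, dens1 S u, dens2 S u, 0)"

definition pt_r :: "'n::finite cl_system \<Rightarrow> real ^ 'n \<Rightarrow> 'n hcoords" where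
  "pt_r S u = (0, flux S u, flux1 S u, flux2 S u, 1)"

definition ruled_hypersurface :: "'n::finite cl_system \<Rightarrow> 'n hcoords set set" where
  "ruled_hypersurface S = ruled (state S) (pt_p S) (pt_r S)"

definition dual_hypersurface :: "'n::finite cl_system \<Rightarrow> ('n hcoords \<Rightarrow>\<^sub>L real) set set" where
  "dual_hypersurface S = dual_of_ruled (state S) (pt_p S) (pt_r S)"

definition dual_systems :: "'n::finite cl_system \<Rightarrow> 'n cl_system \<Rightarrow> bool" where
  "dual_systems S T \<longleftrightarrow> two_additional_laws S \<and> two_additional_laws T \<and>
     proj_equivalent (ruled_hypersurface T) (dual_hypersurface S)"

definition auto_dual :: "'n::finite cl_system \<Rightarrow> bool" where
  "auto_dual S \<longleftrightarrow> dual_systems S S"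


section \<open>Hamiltonian systems and the quadric\<close>

definition sq_norm :: "('n::finite \<Rightarrow> real) \<Rightarrow> real ^ 'n \<Rightarrow> real" where
  "sq_norm \<epsilon> v = (\<Sum>i\<in>UNIV. \<epsilon> i * (v $ i)\<^sup>2)"

definition hamiltonian_system ::
  "('n::finite \<Rightarrow> real) \<Rightarrow> (real ^ 'n) set \<Rightarrow> (real ^ 'n \<Rightarrow> real) \<Rightarrow> 'n cl_system" where
  "hamiltonian_system \<epsilon> U h =
    \<lparr> state = U,
      flux  = (\<lambda>u. \<chi> i. \<epsilon> i * partial i h u),
      dens1 = (\<lambda>u. sq_norm \<epsilon> u / 2),
      flux1 = (\<lambda>u. (\<Sum>i\<in>UNIV. partial i h u * u $ i) - h u),
      dens2 = h,
      flux2 = (\<lambda>u. sq_norm \<epsilon> (\<chi> i. partial i h u) / 2) \<rparr>"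

fun quadric_form :: "('n::finite \<Rightarrow> real) \<Rightarrow> 'n hcoords \<Rightarrow> 'n hcoords \<Rightarrow> real" where
  "quadric_form \<epsilon> (x0, x, xa, xb, xc) (y0, y, ya, yb, yc) =
     (\<Sum>i\<in>UNIV. \<epsilon> i * x $ i * y $ i) - x0 * ya - xa * y0 - xb * yc - xc * yb"

definition polar :: "('n::finite \<Rightarrow> real) \<Rightarrow> 'n hcoords set \<Rightarrow> 'n hcoords set" where
  "polar \<epsilon> P = {Y. \<forall>X\<in>P. quadric_form \<epsilon> X Y = 0}"

end

theory Submission
  imports Defs
begin

text \<open>
  Let \<open>p(u)\<close>, \<open>r(u)\<close> span a ruling. Besides \<open>p\<close> and \<open>r\<close> being isotropic and mutually conjugate,
  the vectors \<open>dp\<close> and \<open>dr\<close> are orthogonal to both \<open>p\<close> and \<open>r\<close> with respect to the quadric. The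
  projective tangent space at a regular point of the ruling has codimension 2, so its orthogonal
  complement is exactly the span of \<open>p\<close> and \<open>r\<close>: the tangent hyperplanes are the polars of the
  points of the ruling. The point \<open>p\<close> itself is always regular. Since the quadric is nondegenerate,
  its polarity is a projective equivalence between the hypersurface and its dual.
\<close>

section \<open>Calculus of smooth maps\<close>

text \<open>\<open>frechet_derivative\<close> chooses among the admissible derivatives. Near
  \<open>x\<close> both functions admit the same ones, so the choices agree even where neither is
  differentiable.\<close>

lemma frechet_derivative_cong_open:
  assumes "open U" "x \<in> U" "\<And>y. y \<in> U \<Longrightarrow> f y = g y"
  shows "frechet_derivative f (at x) = frechet_derivative g (at x)"
proof -
  have "(f has_derivative f') (at x) \<longleftrightarrow> (g has_derivative f') (at x)" for f'
    using has_derivative_transform_within_open[of f f' x UNIV U g]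
      has_derivative_transform_within_open[of g f' x UNIV U f] assms by auto
  then show ?thesis
    unfolding frechet_derivative_def by simp
qed

lemma Ck_on_cong:
  assumes "open U"
  shows "(\<And>x. x \<in> U \<Longrightarrow> f x = g x) \<Longrightarrow> Ck_on k U f \<longleftrightarrow> Ck_on k U g"
proof (induction k arbitrary: f g)
  case 0
  then show ?case by (simp cong: continuous_on_cong)
next
  case (Suc k)
  have "Ck_on k U (\<lambda>x. frechet_derivative f (at x) v) \<longleftrightarrow>
        Ck_on k U (\<lambda>x. frechet_derivative g (at x) v)" for v
    by (rule Suc.IH) (metis Suc.prems assms frechet_derivative_cong_open)
  moreover have "f differentiable_on U \<longleftrightarrow> g differentiable_on U"
    using Suc.prems unfolding differentiable_on_def
    by (metis differentiable_transform_within zero_less_one)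
  ultimately show ?case by simp
qed

lemma Ck_on_SucD: "Ck_on (Suc k) U f \<Longrightarrow> Ck_on k U f"
  by (induction k arbitrary: f) (auto intro: differentiable_imp_continuous_on)

text \<open>Lets an explicit derivative replace the chosen one in the recursion; the closure rules
  below are inductions through this rule.\<close>

lemma Ck_on_SucI:
  assumes "open U" "\<And>x. x \<in> U \<Longrightarrow> (f has_derivative f' x) (at x)"
    and "\<And>v. Ck_on k U (\<lambda>x. f' x v)"
  shows "Ck_on (Suc k) U f"
proof -
  have "f differentiable_on U"
    using assms(2) unfolding differentiable_on_def differentiable_def
    by (meson has_derivative_at_withinI)
  moreover have "Ck_on k U (\<lambda>x. frechet_derivative f (at x) v)" for v
    using Ck_on_cong[OF assms(1), of "\<lambda>x. frechet_derivative f (at x) v" "\<lambda>x. f' x v"]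
      assms(2,3) by (metis frechet_derivative_at)
  ultimately show ?thesis by simp
qed

lemma Ck_on_has_derivative:
  assumes "open U" "Ck_on (Suc k) U f" "x \<in> U"
  shows "(f has_derivative frechet_derivative f (at x)) (at x)"
  using assms by (simp add: differentiable_on_eq_differentiable_at frechet_derivative_works)

lemma Ck_on_const: "Ck_on k U (\<lambda>x. c)"
  by (induction k arbitrary: c) auto

lemma Ck_on_add:
  assumes "open U"
  shows "Ck_on k U f \<Longrightarrow> Ck_on k U g \<Longrightarrow> Ck_on k U (\<lambda>x. f x + g x)"
proof (induction k arbitrary: f g)
  case 0
  then show ?case by (auto intro: continuous_intros)
next
  case (Suc k)
  show ?case
  proof (rule Ck_on_SucI[OF assms])
    show "((\<lambda>x. f x + g x) has_derivative
        (\<lambda>v. frechet_derivative f (at x) v + frechet_derivative g (at x) v)) (at x)"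
      if "x \<in> U" for x
      using Suc.prems[THEN Ck_on_has_derivative[OF assms _ that]] by (rule has_derivative_add)
    show "Ck_on k U (\<lambda>x. frechet_derivative f (at x) v + frechet_derivative g (at x) v)" for v
      using Suc by simp
  qed
qed

text \<open>The Leibniz rule for an arbitrary bounded bilinear map serves real products and scalar
  multiples at once.\<close>

lemma Ck_on_bilinear:
  assumes "open U" and bl: "bounded_bilinear B"
  shows "Ck_on k U f \<Longrightarrow> Ck_on k U g \<Longrightarrow> Ck_on k U (\<lambda>x. B (f x) (g x))"
proof (induction k arbitrary: f g)
  case 0
  then show ?case by (simp add: bounded_bilinear.continuous_on[OF bl])
next
  case (Suc k)
  show ?case
  proof (rule Ck_on_SucI[OF assms(1)])
    show "((\<lambda>x. B (f x) (g x)) has_derivative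
        (\<lambda>v. B (f x) (frechet_derivative g (at x) v) + B (frechet_derivative f (at x) v) (g x)))
        (at x)" if "x \<in> U" for x
      using Suc.prems[THEN Ck_on_has_derivative[OF assms(1) _ that]]
      by (rule bounded_bilinear.FDERIV[OF bl])
    \<comment> \<open>Each Leibniz term keeps one undifferentiated factor, whose order has to be
      lowered by one before the induction hypothesis applies.\<close>
    show "Ck_on k U (\<lambda>x. B (f x) (frechet_derivative g (at x) v)
        + B (frechet_derivative f (at x) v) (g x))" for v
      using Suc.prems Ck_on_SucD[OF Suc.prems(1)] Ck_on_SucD[OF Suc.prems(2)]
      by (intro Ck_on_add[OF assms(1)] Suc.IH) auto
  qed
qed

lemma smooth_on_const: "smooth_on U (\<lambda>x. c)"
  by (simp add: smooth_on_def Ck_on_const)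

lemma smooth_on_add:
  "open U \<Longrightarrow> smooth_on U f \<Longrightarrow> smooth_on U g \<Longrightarrow> smooth_on U (\<lambda>x. f x + g x)"
  by (simp add: smooth_on_def Ck_on_add)

lemma smooth_on_bilinear:
  "open U \<Longrightarrow> bounded_bilinear B \<Longrightarrow> smooth_on U f \<Longrightarrow> smooth_on U g \<Longrightarrow>
    smooth_on U (\<lambda>x. B (f x) (g x))"
  by (simp add: smooth_on_def Ck_on_bilinear)

lemma smooth_on_mult:
  fixes f g :: "'a::euclidean_space \<Rightarrow> real"
  shows "open U \<Longrightarrow> smooth_on U f \<Longrightarrow> smooth_on U g \<Longrightarrow> smooth_on U (\<lambda>x. f x * g x)"
  by (rule smooth_on_bilinear[OF _ bounded_bilinear_mult])

lemma smooth_on_scaleR: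
  "open U \<Longrightarrow> smooth_on U f \<Longrightarrow> smooth_on U g \<Longrightarrow> smooth_on U (\<lambda>x. f x *\<^sub>R g x)"
  by (rule smooth_on_bilinear[OF _ bounded_bilinear_scaleR])

lemma smooth_on_sum:
  assumes "open U" "finite I" "\<And>i. i \<in> I \<Longrightarrow> smooth_on U (f i)"
  shows "smooth_on U (\<lambda>x. \<Sum>i\<in>I. f i x)"
  using assms(2,3)
  by (induction I rule: finite_induct) (auto intro: smooth_on_add assms(1) smooth_on_const)

lemma smooth_on_bounded_linear:
  assumes "open U" "bounded_linear f"
  shows "smooth_on U f"
  unfolding smooth_on_def
proof
  show "Ck_on k U f" for k
  \<comment> \<open>The derivative is \<open>f\<close> at every base point, hence constant in
    \<open>x\<close>: a case split replaces induction.\<close>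
  proof (cases k)
    case 0
    then show ?thesis using assms(2) by (simp add: linear_continuous_on)
  next
    case (Suc m)
    show ?thesis unfolding Suc
      by (rule Ck_on_SucI[OF assms(1), where f' = "\<lambda>_. f"])
        (auto intro: bounded_linear_imp_has_derivative assms(2) Ck_on_const)
  qed
qed

lemma smooth_on_vec_lambda:
  fixes f :: "'n::finite \<Rightarrow> 'a::euclidean_space \<Rightarrow> real"
  assumes "open U" "\<And>i. smooth_on U (f i)"
  shows "smooth_on U (\<lambda>x. \<chi> i. f i x)"
proof -
  have "(\<lambda>x. \<chi> i. f i x) = (\<lambda>x. \<Sum>i\<in>UNIV. f i x *\<^sub>R axis i 1)"
    by (auto simp: vec_eq_iff axis_def if_distrib cong: if_cong)
  then show ?thesis
    using assms by (auto intro!: smooth_on_sum smooth_on_scaleR smooth_on_const)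
qed

lemma smooth_on_partial: "smooth_on U h \<Longrightarrow> smooth_on U (partial i h)"
  unfolding smooth_on_def partial_def by (metis Ck_on.simps(2))

lemma smooth_on_has_derivative:
  assumes "open U" "smooth_on U f" "x \<in> U"
  shows "(f has_derivative frechet_derivative f (at x)) (at x)"
  using assms Ck_on_has_derivative unfolding smooth_on_def by blast

section \<open>Derivatives in coordinates\<close>

lemma has_derivative_vec_lambda:
  fixes f :: "'n::finite \<Rightarrow> 'a::real_normed_vector \<Rightarrow> real"
  assumes "\<And>i. (f i has_derivative f' i) F"
  shows "((\<lambda>x. \<chi> i. f i x) has_derivative (\<lambda>v. \<chi> i. f' i v)) F"
proof -
  have eq: "(\<chi> i. g i) = (\<Sum>i\<in>UNIV. g i *\<^sub>R axis i 1)" for g :: "'n \<Rightarrow> real"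
    by (auto simp: vec_eq_iff axis_def if_distrib cong: if_cong)
  show ?thesis
    unfolding eq by (intro has_derivative_sum has_derivative_scaleR_left assms)
qed

lemma has_derivative_gradient:
  assumes "open U" "smooth_on U h" "u \<in> U"
  shows "(h has_derivative (\<lambda>v. \<Sum>i\<in>UNIV. partial i h u * v $ i)) (at u)"
proof -
  note D = smooth_on_has_derivative[OF assms]
  have "frechet_derivative h (at u) v = (\<Sum>i\<in>UNIV. partial i h u * v $ i)" for v
  proof -
    have "frechet_derivative h (at u) v = frechet_derivative h (at u) (\<Sum>i\<in>UNIV. v $ i *\<^sub>R axis i 1)"
      using basis_expansion[of v] by (simp add: scalar_mult_eq_scaleR)
    also have "\<dots> = (\<Sum>i\<in>UNIV. partial i h u * v $ i)"
      using has_derivative_linear[OF D]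
      by (simp add: linear_sum linear_scale partial_def mult.commute)
    finally show ?thesis .
  qed
  then show ?thesis using D by presburger
qed


section \<open>Hyperplanes and functionals in Euclidean space\<close>

text \<open>Trades codimension one for a nonzero normal vector, on which the polarity can
  act.\<close>

lemma proj_hyperplane_iff:
  fixes H :: "'v::euclidean_space set"
  shows "proj_hyperplane H \<longleftrightarrow> (\<exists>a. a \<noteq> 0 \<and> H = {y. a \<bullet> y = 0})"
proof
  assume H: "proj_hyperplane H"
  then have "dim H = DIM('v) - 1" unfolding proj_hyperplane_def by linarith
  then show "\<exists>a. a \<noteq> 0 \<and> H = {y. a \<bullet> y = 0}"
    using H span_eq_iff[of H] dim_eq_hyperplane[of H] unfolding proj_hyperplane_def by metis
next
  assume "\<exists>a. a \<noteq> 0 \<and> H = {y. a \<bullet> y = 0}"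
  then show "proj_hyperplane H"
    by (auto simp: proj_hyperplane_def subspace_hyperplane dim_hyperplane)
qed

text \<open>The normals of the hyperplanes containing \<open>R\<close> are the nonzero vectors of
  its orthogonal complement. That complement has dimension 2 and contains \<open>a\<close> and
  \<open>b\<close>, so they span it.\<close>

lemma hyperplanes_containing_codim2:
  fixes R :: "'v::euclidean_space set"
  assumes R: "subspace R" "dim R + 2 = DIM('v)"
    and ab: "dim {a, b} = 2"
    and orth: "\<And>y. y \<in> R \<Longrightarrow> a \<bullet> y = 0" "\<And>y. y \<in> R \<Longrightarrow> b \<bullet> y = 0"
  shows "{H. proj_hyperplane H \<and> R \<subseteq> H} = (\<lambda>c. {y. c \<bullet> y = 0}) ` (span {a, b} - {0})"
proof -
  define P where "P = {y. \<forall>x\<in>R. orthogonal x y}"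
  have "subspace P"
    unfolding P_def by (rule subspace_orthogonal_to_vectors)
  moreover have "span {a, b} \<subseteq> P"
    using orth \<open>subspace P\<close>
    by (intro span_minimal) (auto simp: P_def orthogonal_def inner_commute)
  moreover have "dim P = 2"
    using dim_subspace_orthogonal_to_vectors[OF R(1) subspace_UNIV] R(2) by (simp add: P_def)
  ultimately have P: "span {a, b} = P"
    using ab by (intro subspace_dim_equal) auto
  have "R \<subseteq> {y. c \<bullet> y = 0} \<longleftrightarrow> c \<in> P" for c
    by (auto simp: P_def orthogonal_def inner_commute)
  then show ?thesis
    unfolding P by (auto simp: proj_hyperplane_iff)
qed

text \<open>The Riesz identification of a Euclidean space with its dual; the representing vector has
  the values of the functional on \<open>Basis\<close> as coordinates.\<close>

lemma bij_blinfun_inner_right: "bij (blinfun_inner_right :: 'v::euclidean_space \<Rightarrow> 'v \<Rightarrow>\<^sub>L real)"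
proof (rule bijI)
  show "inj (blinfun_inner_right :: 'v \<Rightarrow> _)"
    by (rule injI) (metis blinfun_inner_right.rep_eq vector_eq_rdot)
  have "\<phi> = blinfun_inner_right (\<Sum>b\<in>Basis. \<phi> b *\<^sub>R b)" for \<phi> :: "'v \<Rightarrow>\<^sub>L real"
  proof (rule blinfun_eqI)
    fix y :: 'v
    have "\<phi> y = \<phi> (\<Sum>b\<in>Basis. (y \<bullet> b) *\<^sub>R b)"
      by (simp add: euclidean_representation)
    also have "\<dots> = (\<Sum>b\<in>Basis. \<phi> b *\<^sub>R b) \<bullet> y"
      by (simp add: blinfun.sum_right blinfun.scaleR_right inner_sum_left inner_commute[of y]
          mult.commute)
    finally show "\<phi> y = blinfun_inner_right (\<Sum>b\<in>Basis. \<phi> b *\<^sub>R b) y"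
      by simp
  qed
  then show "surj (blinfun_inner_right :: 'v \<Rightarrow> _)" unfolding surj_def by blast
qed

lemma linear_blinfun_inner_right: "linear (blinfun_inner_right :: 'v::euclidean_space \<Rightarrow> _)"
  by (rule linearI) (auto intro!: blinfun_eqI simp: inner_add_left blinfun.add_left blinfun.scaleR_left)

lemma dual_point_hyperplane:
  fixes a :: "'v::euclidean_space"
  assumes "a \<noteq> 0"
  shows "dual_point {y. a \<bullet> y = 0} = blinfun_inner_right ` span {a}"
proof
  show "dual_point {y. a \<bullet> y = 0} \<subseteq> blinfun_inner_right ` span {a}"
  proof
    fix \<phi> assume \<phi>: "\<phi> \<in> dual_point {y. a \<bullet> y = 0}"
    obtain b where b: "\<phi> = blinfun_inner_right b"
      using bij_blinfun_inner_right by (metis bij_pointE)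
    \<comment> \<open>The component of \<open>b\<close> orthogonal to \<open>a\<close>. It lies in
      the hyperplane, so \<open>\<phi>\<close> kills it; then \<open>c \<bullet> c = 0\<close>
      forces \<open>b\<close> onto the line of \<open>a\<close>.\<close>
    define c where "c = b - ((a \<bullet> b) / (a \<bullet> a)) *\<^sub>R a"
    have ac: "a \<bullet> c = 0"
      using assms by (simp add: c_def inner_diff_right)
    then have "b \<bullet> c = 0"
      using \<phi> by (simp add: dual_point_def b)
    then have "c \<bullet> c = 0"
      using ac by (simp add: c_def inner_diff_left)
    then have "b = ((a \<bullet> b) / (a \<bullet> a)) *\<^sub>R a"
      by (simp add: c_def)
    then have "b \<in> span {a}"
      by (metis span_base span_scale singletonI)
    then show "\<phi> \<in> blinfun_inner_right ` span {a}"
      using b by blast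
  qed
  show "blinfun_inner_right ` span {a} \<subseteq> dual_point {y. a \<bullet> y = 0}"
    by (auto simp: dual_point_def span_singleton)
qed

section \<open>The quadric and its Gram operator\<close>

fun gram :: "('n::finite \<Rightarrow> real) \<Rightarrow> 'n hcoords \<Rightarrow> 'n hcoords" where
  "gram \<epsilon> (x0, x, xa, xb, xc) = (- xa, (\<chi> i. \<epsilon> i * x $ i), - x0, - xc, - xb)"

text \<open>Turns conjugacy into Euclidean orthogonality, so the polar of \<open>[X]\<close> is the
  hyperplane with normal \<open>gram \<epsilon> X\<close>.\<close>

lemma quadric_form_gram: "quadric_form \<epsilon> X Y = gram \<epsilon> X \<bullet> Y"
  by (cases X; cases Y) (simp add: inner_vec_def)

lemma linear_gram: "linear (gram \<epsilon>)"
  by (rule linearI) (auto simp: vec_eq_iff algebra_simps)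

lemma polar_span: "polar \<epsilon> (span {X}) = {Y. gram \<epsilon> X \<bullet> Y = 0}"
  by (auto simp: polar_def quadric_form_gram span_singleton linear_scale[OF linear_gram]
      intro: exI[of _ 1])

lemma generator_eq: "generator p r u = (\<lambda>X. span {X}) ` (span {p u, r u} - {0})"
  by (auto simp: generator_def)

section \<open>The conservation laws\<close>

text \<open>The halving absorbs the 2 from the squares. Arbitrary components \<open>f i\<close> let
  the rule serve \<open>u\<close>, the gradient of \<open>h\<close>, and both along a
  solution.\<close>

lemma has_derivative_sq_norm:
  assumes "\<And>i. (f i has_derivative f' i) (at z)"
  shows "((\<lambda>z. sq_norm \<epsilon> (\<chi> i. f i z) / 2) has_derivative
    (\<lambda>v. \<Sum>i\<in>UNIV. \<epsilon> i * f i z * f' i v)) (at z)"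
proof -
  have "((\<lambda>z. (\<Sum>i\<in>UNIV. \<epsilon> i * (f i z * f i z)) / 2) has_derivative
    (\<lambda>v. (\<Sum>i\<in>UNIV. \<epsilon> i * (f i z * f' i v + f' i v * f i z)) / 2)) (at z)"
    by (intro bounded_linear.has_derivative[OF bounded_linear_divide] has_derivative_sum
        has_derivative_mult_right has_derivative_mult assms)
  moreover have "(\<Sum>i\<in>UNIV. \<epsilon> i * (f i z * f' i v + f' i v * f i z)) / 2
      = (\<Sum>i\<in>UNIV. \<epsilon> i * f i z * f' i v)" for v
    by (simp add: sum_divide_distrib algebra_simps)
  ultimately show ?thesis
    by (simp add: sq_norm_def power2_eq_square)
qed

lemma smooth_on_sq_norm:
  assumes "open U" "\<And>i. smooth_on U (f i)"
  shows "smooth_on U (\<lambda>u. sq_norm \<epsilon> (\<chi> i. f i u) / 2)"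
proof -
  have "smooth_on U (\<lambda>u. (\<Sum>i\<in>UNIV. \<epsilon> i * (f i u * f i u)) * (1 / 2))"
    using assms by (intro smooth_on_mult smooth_on_sum smooth_on_const) auto
  then show ?thesis by (simp add: sq_norm_def power2_eq_square)
qed

lemma smooth_on_component: "open U \<Longrightarrow> smooth_on U (\<lambda>u. u $ i)"
  by (rule smooth_on_bounded_linear[OF _ bounded_linear_vec_nth])

context
  fixes U :: "(real ^ 'n::finite) set" and \<epsilon> :: "'n \<Rightarrow> real" and h :: "real ^ 'n \<Rightarrow> real"
  assumes openU: "open U" and smooth_h: "smooth_on U h"
    and eps: "\<And>i. \<epsilon> i = 1 \<or> \<epsilon> i = -1"
begin

lemma eps_sq [simp]: "\<epsilon> i * \<epsilon> i = 1" "\<epsilon> i * (\<epsilon> i * x) = x"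
  using eps[of i] by auto

lemma partial_has_derivative:
  "u \<in> U \<Longrightarrow> (partial i h has_derivative frechet_derivative (partial i h) (at u)) (at u)"
  by (intro smooth_on_has_derivative[OF openU] smooth_on_partial smooth_h)

text \<open>The terms \<open>h\<^sub>i du\<^sup>i\<close> cancel against \<open>dh\<close>: the first flux is the Legendre transform of \<open>h\<close>.\<close>

lemma flux1_has_derivative:
  assumes u: "u \<in> U"
  shows "((\<lambda>u. (\<Sum>i\<in>UNIV. partial i h u * u $ i) - h u) has_derivative
    (\<lambda>v. \<Sum>i\<in>UNIV. frechet_derivative (partial i h) (at u) v * u $ i)) (at u)"
proof -
  have "((\<lambda>u. (\<Sum>i\<in>UNIV. partial i h u * u $ i) - h u) has_derivative
    (\<lambda>v. (\<Sum>i\<in>UNIV. partial i h u * v $ i + frechet_derivative (partial i h) (at u) v * u $ i)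
      - (\<Sum>i\<in>UNIV. partial i h u * v $ i))) (at u)"
    by (intro has_derivative_diff has_derivative_sum has_derivative_mult partial_has_derivative u
        has_derivative_gradient[OF openU smooth_h]
        bounded_linear_imp_has_derivative bounded_linear_vec_nth)
  then show ?thesis by (simp add: sum.distrib)
qed

lemma smooth_on_flux1: "smooth_on U (\<lambda>u. (\<Sum>i\<in>UNIV. partial i h u * u $ i) - h u)"
proof -
  have "smooth_on U (\<lambda>u. (\<Sum>i\<in>UNIV. partial i h u * u $ i) + (-1) * h u)"
    by (intro smooth_on_add smooth_on_sum smooth_on_mult smooth_on_const smooth_on_partial
        smooth_on_component openU smooth_h finite)
  then show ?thesis by simp
qed

text \<open>The system at one point of a solution, with \<open>w' (0, 1)\<close> the
  \<open>t\<close>-derivative and \<open>w' (1, 0)\<close> the \<open>x\<close>-derivative. As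
  \<epsilon> squares to 1, the sign moves to the left, the form both conservation laws
  consume.\<close>

lemma solution_derivatives:
  assumes sol: "solution (hamiltonian_system \<epsilon> U h) W w" and z: "z \<in> W"
  obtains w' where "(w has_derivative w') (at z)" "w z \<in> U"
    and "\<And>i. \<epsilon> i * w' (0, 1) $ i = frechet_derivative (partial i h) (at (w z)) (w' (1, 0))"
proof -
  define w' where "w' = frechet_derivative w (at z)"
  have w': "(w has_derivative w') (at z)"
    unfolding w'_def using sol z by (intro smooth_on_has_derivative) (auto simp: solution_def)
  have wz: "w z \<in> U"
    using sol z by (auto simp: solution_def hamiltonian_system_def)
  have "((\<lambda>z. \<chi> i. \<epsilon> i * partial i h (w z)) has_derivative
    (\<lambda>v. \<chi> i. \<epsilon> i * frechet_derivative (partial i h) (at (w z)) (w' v))) (at z)"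
    by (intro has_derivative_vec_lambda has_derivative_mult_right
        has_derivative_compose[OF w'] partial_has_derivative wz)
  then have "d_x (\<lambda>z. flux (hamiltonian_system \<epsilon> U h) (w z)) z
    = (\<chi> i. \<epsilon> i * frechet_derivative (partial i h) (at (w z)) (w' (1, 0)))"
    by (simp add: d_x_def hamiltonian_system_def frechet_derivative_at[symmetric])
  moreover have "d_t w z = w' (0, 1)"
    by (simp add: d_t_def w'_def)
  ultimately have "w' (0, 1) = (\<chi> i. \<epsilon> i * frechet_derivative (partial i h) (at (w z)) (w' (1, 0)))"
    using sol z by (simp add: solution_def)
  then show ?thesis
    using that[OF w' wz] by simp
qed

lemma hamiltonian_two_additional_laws:
  assumes "independent_forms (hamiltonian_system \<epsilon> U h)"
  shows "two_additional_laws (hamiltonian_system \<epsilon> U h)"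
proof -
  let ?S = "hamiltonian_system \<epsilon> U h"
  have flux: "smooth_on U (flux ?S)"
    unfolding hamiltonian_system_def
    by (auto intro!: smooth_on_vec_lambda smooth_on_mult smooth_on_const smooth_on_partial
        openU smooth_h)
  have "conservation_law ?S (dens1 ?S) (flux1 ?S)"
    unfolding conservation_law_def
  proof (intro conjI allI impI ballI)
    show "smooth_on (state ?S) (dens1 ?S)"
      using smooth_on_sq_norm[OF openU, of "\<lambda>i u. u $ i"] smooth_on_component[OF openU]
      by (simp add: hamiltonian_system_def)
    show "smooth_on (state ?S) (flux1 ?S)"
      using smooth_on_flux1 by (simp add: hamiltonian_system_def)
    fix W w z assume "solution ?S W w" "z \<in> W"
    then obtain w' where w': "(w has_derivative w') (at z)" "w z \<in> U"
      and eq: "\<And>i. \<epsilon> i * w' (0, 1) $ i = frechet_derivative (partial i h) (at (w z)) (w' (1, 0))"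
      using solution_derivatives by blast
    have "((\<lambda>z. sq_norm \<epsilon> (\<chi> i. w z $ i) / 2) has_derivative
        (\<lambda>v. \<Sum>i\<in>UNIV. \<epsilon> i * w z $ i * w' v $ i)) (at z)"
      by (intro has_derivative_sq_norm bounded_linear.has_derivative[OF bounded_linear_vec_nth] w')
    moreover have "((\<lambda>z. (\<Sum>i\<in>UNIV. partial i h (w z) * w z $ i) - h (w z)) has_derivative
        (\<lambda>v. \<Sum>i\<in>UNIV. frechet_derivative (partial i h) (at (w z)) (w' v) * w z $ i)) (at z)"
      using has_derivative_compose[OF w'(1) flux1_has_derivative[OF w'(2)]] .
    \<comment> \<open>By \<open>eq\<close>, both sides equal the sum of
      \<open>\<epsilon> i * w z $ i * w' (0, 1) $ i\<close>.\<close>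
    ultimately show "d_t (\<lambda>z. dens1 ?S (w z)) z = d_x (\<lambda>z. flux1 ?S (w z)) z"
      by (simp add: d_t_def d_x_def hamiltonian_system_def frechet_derivative_at[symmetric]
          eq[symmetric] mult_ac)
  qed
  moreover have "conservation_law ?S (dens2 ?S) (flux2 ?S)"
    unfolding conservation_law_def
  proof (intro conjI allI impI ballI)
    show "smooth_on (state ?S) (dens2 ?S)"
      using smooth_h by (simp add: hamiltonian_system_def)
    show "smooth_on (state ?S) (flux2 ?S)"
      using smooth_on_sq_norm[OF openU smooth_on_partial[OF smooth_h]]
      by (simp add: hamiltonian_system_def)
    fix W w z assume "solution ?S W w" "z \<in> W"
    then obtain w' where w': "(w has_derivative w') (at z)" "w z \<in> U"
      and eq: "\<And>i. \<epsilon> i * w' (0, 1) $ i = frechet_derivative (partial i h) (at (w z)) (w' (1, 0))"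
      using solution_derivatives by blast
    have "((\<lambda>z. h (w z)) has_derivative (\<lambda>v. \<Sum>i\<in>UNIV. partial i h (w z) * w' v $ i)) (at z)"
      using has_derivative_compose[OF w'(1) has_derivative_gradient[OF openU smooth_h w'(2)]] .
    moreover have "((\<lambda>z. sq_norm \<epsilon> (\<chi> i. partial i h (w z)) / 2) has_derivative
        (\<lambda>v. \<Sum>i\<in>UNIV. \<epsilon> i * partial i h (w z) * frechet_derivative (partial i h) (at (w z)) (w' v)))
        (at z)"
      by (intro has_derivative_sq_norm has_derivative_compose[OF w'(1)] partial_has_derivative w')
    \<comment> \<open>Inserting \<open>eq\<close> on the right produces a second factor
      \<open>\<epsilon> i\<close>; the two signs cancel and leave the chain rule for
      \<open>h\<close>.\<close>
    ultimately show "d_t (\<lambda>z. dens2 ?S (w z)) z = d_x (\<lambda>z. flux2 ?S (w z)) z"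
      by (simp add: d_t_def d_x_def hamiltonian_system_def frechet_derivative_at[symmetric]
          eq[symmetric] mult_ac)
  qed
  ultimately show ?thesis
    using flux openU assms by (simp add: two_additional_laws_def) (simp add: hamiltonian_system_def)
qed

section \<open>The polarity of the quadric\<close>

text \<open>The signs square to 1 and the negated coordinate swaps undo themselves. This is the
  nondegeneracy of the quadric.\<close>

lemma gram_gram: "gram \<epsilon> (gram \<epsilon> X) = X"
  by (cases X) (simp add: vec_eq_iff)

lemma bij_gram: "bij (gram \<epsilon>)"
  using gram_gram by (metis bij_iff)

lemma gram_eq_0_iff: "gram \<epsilon> X = 0 \<longleftrightarrow> X = 0"
  using gram_gram linear_0[OF linear_gram] by metis

text \<open>\<open>dp u v\<close> and \<open>dr u v\<close> are the differentials of
  \<open>pt_p\<close> and \<open>pt_r\<close> in direction \<open>v\<close>. Their outer coordinates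
  vanish because those of \<open>pt_p\<close> and \<open>pt_r\<close> are constant.\<close>

definition dp :: "real ^ 'n \<Rightarrow> real ^ 'n \<Rightarrow> 'n hcoords" where
  "dp u v = (0, v, \<Sum>i\<in>UNIV. \<epsilon> i * u $ i * v $ i, \<Sum>i\<in>UNIV. partial i h u * v $ i, 0)"

definition dr :: "real ^ 'n \<Rightarrow> real ^ 'n \<Rightarrow> 'n hcoords" where
  "dr u v = (0, \<chi> i. \<epsilon> i * frechet_derivative (partial i h) (at u) v,
     \<Sum>i\<in>UNIV. frechet_derivative (partial i h) (at u) v * u $ i,
     \<Sum>i\<in>UNIV. \<epsilon> i * partial i h u * frechet_derivative (partial i h) (at u) v, 0)"

abbreviation (input) "sys \<equiv> hamiltonian_system \<epsilon> U h"

lemma pt_p_has_derivative: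
  assumes "u \<in> U"
  shows "(pt_p sys has_derivative dp u) (at u)"
proof -
  have "((\<lambda>u. (1, u, sq_norm \<epsilon> (\<chi> i. u $ i) / 2, h u, 0)) has_derivative dp u) (at u)"
    unfolding dp_def
    by (intro has_derivative_Pair has_derivative_const has_derivative_ident has_derivative_sq_norm
        has_derivative_gradient[OF openU smooth_h assms]
        bounded_linear_imp_has_derivative bounded_linear_vec_nth)
  then show ?thesis
    by (simp add: pt_p_def[abs_def] hamiltonian_system_def)
qed

lemma pt_r_has_derivative:
  assumes "u \<in> U"
  shows "(pt_r sys has_derivative dr u) (at u)"
proof -
  note pd = partial_has_derivative[OF assms]
  show ?thesis
    unfolding dr_def pt_r_def[abs_def] hamiltonian_system_def cl_system.simps
    by (intro has_derivative_Pair has_derivative_const has_derivative_vec_lambda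
        has_derivative_mult_right has_derivative_sq_norm pd
        flux1_has_derivative[OF assms])
qed

section \<open>Tangent spaces of the affine cone\<close>

lemma cone_param_derivative:
  assumes "u \<in> U"
  shows "frechet_derivative (cone_param (pt_p sys) (pt_r sys)) (at (u, s, t)) =
    (\<lambda>(v, a, b). s *\<^sub>R dp u v + a *\<^sub>R pt_p sys u + t *\<^sub>R dr u v + b *\<^sub>R pt_r sys u)"
proof -
  let ?z = "(u, s, t)"
  have p: "((\<lambda>z. pt_p sys (fst z)) has_derivative (\<lambda>z. dp u (fst z))) (at ?z)"
    using has_derivative_compose[of fst fst ?z UNIV "pt_p sys" "dp u"]
      pt_p_has_derivative[OF assms] by (simp add: bounded_linear_fst bounded_linear_imp_has_derivative)
  have r: "((\<lambda>z. pt_r sys (fst z)) has_derivative (\<lambda>z. dr u (fst z))) (at ?z)"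
    using has_derivative_compose[of fst fst ?z UNIV "pt_r sys" "dr u"]
      pt_r_has_derivative[OF assms] by (simp add: bounded_linear_fst bounded_linear_imp_has_derivative)
  have fs: "((\<lambda>z. fst (snd z)) has_derivative (\<lambda>z. fst (snd z))) (at ?z)"
    and ss: "((\<lambda>z. snd (snd z)) has_derivative (\<lambda>z. snd (snd z))) (at ?z)"
    by (intro has_derivative_fst has_derivative_snd has_derivative_ident)+
  note has_derivative_add[OF has_derivative_scaleR[OF fs p] has_derivative_scaleR[OF ss r]]
  then show ?thesis
    by (simp add: cone_param_def case_prod_beta' frechet_derivative_at[symmetric] algebra_simps)
qed

text \<open>
  With respect to the quadric, each point of a ruling is conjugate to the tangent space at every
  point of that ruling, not only at its own.
\<close>

lemma gram_orthogonal_tangent: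
  "gram \<epsilon> (pt_p sys u) \<bullet> pt_p sys u = 0" "gram \<epsilon> (pt_p sys u) \<bullet> pt_r sys u = 0"
  "gram \<epsilon> (pt_r sys u) \<bullet> pt_p sys u = 0" "gram \<epsilon> (pt_r sys u) \<bullet> pt_r sys u = 0"
  "gram \<epsilon> (pt_p sys u) \<bullet> dp u v = 0" "gram \<epsilon> (pt_p sys u) \<bullet> dr u v = 0"
  "gram \<epsilon> (pt_r sys u) \<bullet> dp u v = 0" "gram \<epsilon> (pt_r sys u) \<bullet> dr u v = 0"
  \<comment> \<open>After \<epsilon> squares to 1, the vector block cancels one density or flux
    coordinate, or twice the halved one for \<open>p\<close> or \<open>r\<close> with itself. For
    \<open>p\<close> against \<open>r\<close>, the \<open>- h\<close> inside the first flux offsets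
    the \<open>h\<close> of the second density.\<close>
  by (simp_all add: pt_p_def pt_r_def dp_def dr_def hamiltonian_system_def inner_vec_def
      sq_norm_def power2_eq_square mult_ac)

text \<open>At \<open>p\<close> the first coordinate of the differential reads off \<open>a\<close>
  and the last one \<open>b\<close>; the vector block then recovers \<open>v\<close>.\<close>

lemma regular_point:
  assumes "u \<in> U"
  shows "inj (frechet_derivative (cone_param (pt_p sys) (pt_r sys)) (at (u, 1, 0)))"
  unfolding cone_param_derivative[OF assms]
  by (rule injI) (auto simp: dp_def pt_p_def pt_r_def)

text \<open>The answer is free of \<open>s\<close> and \<open>t\<close>: the tangent space is the
  same at all regular points of a ruling, and the pencil of hyperplanes through it is the polar
  image of the whole ruling.\<close>

lemma tangent_hyperplanes_regular:
  assumes u: "u \<in> U"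
    and inj: "inj (frechet_derivative (cone_param (pt_p sys) (pt_r sys)) (at (u, s, t)))"
  shows "tangent_hyperplanes_at (pt_p sys) (pt_r sys) (u, s, t) =
    polar \<epsilon> ` generator (pt_p sys) (pt_r sys) u"
proof -
  let ?D = "frechet_derivative (cone_param (pt_p sys) (pt_r sys)) (at (u, s, t))"
  let ?p = "pt_p sys u" and ?r = "pt_r sys u"
  note D = cone_param_derivative[OF u, of s t]
  have lin_dp: "linear (dp u)" and lin_dr: "linear (dr u)"
    using pt_p_has_derivative[OF u] pt_r_has_derivative[OF u] has_derivative_linear by blast+
  have lin: "linear ?D"
    unfolding D
    by (rule linearI)
      (auto simp: linear_add[OF lin_dp] linear_add[OF lin_dr] linear_scale[OF lin_dp]
        linear_scale[OF lin_dr] algebra_simps)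
  \<comment> \<open>Regularity enters here: injectivity gives dimension \<open>n + 2\<close> inside
    an ambient space of dimension \<open>n + 4\<close>.\<close>
  have "dim (range ?D) = DIM((real ^ 'n) \<times> real \<times> real)"
    using dim_image_eq[OF lin, of UNIV] inj by simp
  then have R: "dim (range ?D) + 2 = DIM('n hcoords)" by simp
  \<comment> \<open>The outer coordinates are 1, 0 for \<open>p\<close> and 0, 1 for
    \<open>r\<close>.\<close>
  have "?r \<notin> span {?p}"
    by (auto simp: span_singleton pt_p_def pt_r_def)
  moreover have "?p \<noteq> 0" by (simp add: pt_p_def zero_prod_def)
  ultimately have "independent {?r, ?p}" "?r \<noteq> ?p"
    by (auto simp: independent_insert intro: span_base)
  then have "dim {?p, ?r} = 2"
    by (simp add: dim_eq_card_independent insert_commute)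
  moreover have "dim (gram \<epsilon> ` {?p, ?r}) = dim {?p, ?r}"
    using bij_gram by (intro dim_image_eq linear_gram) (auto simp: bij_def intro: inj_on_subset)
  ultimately have pr: "dim {gram \<epsilon> ?p, gram \<epsilon> ?r} = 2" by simp
  have orth: "gram \<epsilon> ?p \<bullet> y = 0" "gram \<epsilon> ?r \<bullet> y = 0" if "y \<in> range ?D" for y
    using that unfolding D by (auto simp: inner_add_right gram_orthogonal_tangent)
  have "{H. proj_hyperplane H \<and> range ?D \<subseteq> H} =
      (\<lambda>c. {y. c \<bullet> y = 0}) ` (span {gram \<epsilon> ?p, gram \<epsilon> ?r} - {0})"
    by (rule hyperplanes_containing_codim2[OF linear_subspace_image[OF lin subspace_UNIV] R pr orth])
  \<comment> \<open>The admissible normals are exactly the Gram images of nonzero vectors of the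
    ruling, that is, the normals of their polars.\<close>
  also have "span {gram \<epsilon> ?p, gram \<epsilon> ?r} - {0} = gram \<epsilon> ` (span {?p, ?r} - {0})"
    using linear_span_image[OF linear_gram, of \<epsilon> "{?p, ?r}"]
    by (simp add: image_set_diff[OF bij_is_inj[OF bij_gram]] linear_0[OF linear_gram])
  also have "(\<lambda>c. {y. c \<bullet> y = 0}) ` gram \<epsilon> ` (span {?p, ?r} - {0}) =
      polar \<epsilon> ` generator (pt_p sys) (pt_r sys) u"
    by (simp add: image_image polar_span[symmetric] generator_eq)
  finally show ?thesis
    using inj by (simp add: tangent_hyperplanes_at_def)
qed

text \<open>Irregular points contribute no tangent hyperplanes by definition, regular ones all
  contribute the same set, and the point \<open>p\<close> guarantees that a regular one
  exists.\<close>

lemma tangent_hyperplanes_along_eq: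
  assumes "u \<in> U"
  shows "tangent_hyperplanes_along (pt_p sys) (pt_r sys) u =
    polar \<epsilon> ` generator (pt_p sys) (pt_r sys) u"
proof
  show "tangent_hyperplanes_along (pt_p sys) (pt_r sys) u \<subseteq>
      polar \<epsilon> ` generator (pt_p sys) (pt_r sys) u"
  proof
    fix H assume "H \<in> tangent_hyperplanes_along (pt_p sys) (pt_r sys) u"
    then obtain s t where H: "H \<in> tangent_hyperplanes_at (pt_p sys) (pt_r sys) (u, s, t)"
      by (auto simp: tangent_hyperplanes_along_def)
    then have "inj (frechet_derivative (cone_param (pt_p sys) (pt_r sys)) (at (u, s, t)))"
      by (simp add: tangent_hyperplanes_at_def)
    with H show "H \<in> polar \<epsilon> ` generator (pt_p sys) (pt_r sys) u"
      by (simp add: tangent_hyperplanes_regular[OF assms])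
  qed
  show "polar \<epsilon> ` generator (pt_p sys) (pt_r sys) u \<subseteq>
      tangent_hyperplanes_along (pt_p sys) (pt_r sys) u"
    unfolding tangent_hyperplanes_along_def
      tangent_hyperplanes_regular[OF assms regular_point[OF assms], symmetric] by blast
qed

section \<open>The dual hypersurface and auto-duality\<close>

lemma dual_hypersurface_eq:
  "dual_hypersurface sys = (\<lambda>P. dual_point (polar \<epsilon> P)) ` ruled_hypersurface sys"
proof -
  have "state sys = U" by (simp add: hamiltonian_system_def)
  then show ?thesis
    by (simp add: dual_hypersurface_def dual_of_ruled_def ruled_hypersurface_def ruled_def
        tangent_hyperplanes_along_eq image_UN image_image)
qed

lemma proj_equivalent_dual: "proj_equivalent (ruled_hypersurface sys) (dual_hypersurface sys)"
proof -
  \<comment> \<open>The polarity as a linear map to the dual space: \<open>?L X\<close> is the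
    functional \<open>quadric_form \<epsilon> X\<close>, whose kernel is the polar hyperplane when
    \<open>X\<close> is nonzero.\<close>
  let ?L = "\<lambda>X. blinfun_inner_right (gram \<epsilon> X)"
  have "linear ?L"
    using linear_compose[OF linear_gram linear_blinfun_inner_right] by (simp add: o_def)
  moreover have "bij ?L"
    using bij_comp[OF bij_gram bij_blinfun_inner_right] by (simp add: o_def)
  moreover have "dual_point (polar \<epsilon> P) = ?L ` P" if P: "P \<in> ruled_hypersurface sys" for P
  proof -
    obtain X where X: "P = span {X}" "X \<noteq> 0"
      using P by (auto simp: ruled_hypersurface_def ruled_def generator_def)
    then show ?thesis
      using linear_span_image[OF linear_gram, of \<epsilon> "{X}"]
      by (simp add: polar_span dual_point_hyperplane gram_eq_0_iff image_image[symmetric])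
  qed
  ultimately show ?thesis
    unfolding proj_equivalent_def dual_hypersurface_eq
    by (intro exI[of _ ?L]) (auto intro!: image_cong)
qed

end

theorem theorem7:
  fixes U :: "(real ^ 'n::finite) set"
    and \<epsilon> :: "'n \<Rightarrow> real"
    and h :: "real ^ 'n \<Rightarrow> real"
  assumes "open U"
    and "smooth_on U h"
    and "\<And>i. \<epsilon> i = 1 \<or> \<epsilon> i = -1"
    and "independent_forms (hamiltonian_system \<epsilon> U h)"
  shows "auto_dual (hamiltonian_system \<epsilon> U h) \<and>
    dual_hypersurface (hamiltonian_system \<epsilon> U h) =
      (\<lambda>P. dual_point (polar \<epsilon> P)) ` ruled_hypersurface (hamiltonian_system \<epsilon> U h) \<and>
    (\<forall>u\<in>U.
      tangent_hyperplanes_along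
          (pt_p (hamiltonian_system \<epsilon> U h)) (pt_r (hamiltonian_system \<epsilon> U h)) u =
        polar \<epsilon> ` generator
          (pt_p (hamiltonian_system \<epsilon> U h)) (pt_r (hamiltonian_system \<epsilon> U h)) u)"
  using hamiltonian_two_additional_laws[OF assms] proj_equivalent_dual[OF assms(1-3)]
    dual_hypersurface_eq[OF assms(1-3)] tangent_hyperplanes_along_eq[OF assms(1-3)]
  by (simp add: auto_dual_def dual_systems_def)

end
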